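(* Let $d$ be a positive integer, let $G=(V,E)$ be a finite connected graph with vertices $v_1,\dots,v_n$ and edges $e_1,\dots,e_m$, let $A_G$ be its incidence matrix, and let $f_E:E\to\mathbb{Z}_d$ be an e-labeling. The following statements are equivalent: (i) $(G,f_E)$ is compatible. (ii) $\langle \pi_d(\omega_C),f_E\rangle\equiv 0\pmod d$ for every cycle $C$ of $G$ for which $\omega_C$ is defined (every cycle of even length, and, when $d$ is even, also every cycle of odd length). (iii) $\langle \omega,f_E\rangle\equiv 0\pmod d$ for all $\omega\in\ker_{\mathbb{Z}_d}(A_G)$. (iv) Let $S$ be a finite set of generators of $\ker_{\mathbb{Z}}(A_G)$. If $d$ is odd or $G$ has no cycles of odd length: $\langle\omega,f_E\rangle\equiv 0\pmod d$ for all $\omega\in\pi_d(S)$. If $d$ is even and $G$ has a cycle of odd length: $\langle\omega,f_E\rangle\equiv0\pmod d$ for all $\omega\in\pi_d(S)$ and for $\omega=\pi_d(\omega_C)$ for some cycle $C$ of odd length. (v) $(G,f_E)$ is additive.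
   Context: $\mathbb{Z}_d$ denotes the integers modulo $d$. A v-labeling $f_V:V\to\mathbb{Z}_d$ is valid for $(G,f_E)$ if $f_E((v,v'))\equiv f_V(v)+f_V(v')\pmod d$ for every edge $(v,v')$; $(G,f_E)$ is additive if a valid v-labeling exists. A cycle of length $k$ is a closed walk, not necessarily simple: vertices $v_1,\dots,v_k$ (repetitions allowed) and edges $e_1,\dots,e_k$ with $e_i=(v_i,v_{i+1})$ for $i<k$ and $e_k=(v_k,v_1)$. Even cycle property: every cycle of even length with edges $e_1,\dots,e_{2k}$ satisfies $\sum_{l\text{ odd}}f_E(e_l)\equiv\sum_{l\text{ even}}f_E(e_l)\pmod d$. Odd cycle property ($d$ even): every cycle of odd length with edges $e_1,\dots,e_{2k+1}$ satisfies $\frac d2\sum_l f_E(e_l)\equiv0\pmod d$. Compatible: $d$ odd and the even cycle property holds, or $d$ even and both properties hold. The incidence matrix $A_G\in\mathbb{Z}^{n\times m}$ has $(i,j)$ entry $1$ if $v_i$ is incident with $e_j$ and $0$ otherwise. $\ker_{\mathbb{Z}}(A_G)=\{x\in\mathbb{Z}^m: A_Gx=0\}$, $\ker_{\mathbb{Z}_d}(A_G)=\{x\in\mathbb{Z}_d^m: A_Gx\equiv0\pmod d\}$, and $\pi_d:\mathbb{Z}^m\to\mathbb{Z}_d^m$ is coordinatewise reduction mod $d$. For $\omega$ indexed by edges, $\langle\omega,f_E\rangle=\sum_{e\in E}\omega_e f_E(e)$. For a cycle $C$ with consecutive edges $e_1,\dots,e_k$ (starting at any edge): if $k$ is even, attach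 the coefficient $(-1)^{i+1}$ to $e_i$; if $k$ is odd and $d$ is even, attach the coefficient $d/2$ to each $e_i$. Then $\omega_C\in\mathbb{Z}^m$ has, for each edge $e$ of $G$, coordinate $(\omega_C)_e$ equal to the sum of the coefficients attached to all occurrences of $e$ in $e_1,\dots,e_k$ (and $0$ if $e$ does not occur). (For even cycles $\omega_C$ is defined up to sign.) *)

theory Defs
  imports
    "HOL-Number_Theory.Cong"
    "HOL-Algebra.Generated_Groups"
    "Jordan_Normal_Form.Matrix"
    "Jordan_Normal_Form.Matrix_Kernel"
begin

(* Graphs are simple: an edge is a two-element set of vertices, so there are no loops and
   no parallel edges. *)
definition finite_graph :: "'a set \<Rightarrow> 'a set set \<Rightarrow> bool" where
  "finite_graph V E \<longleftrightarrow> finite V \<and> (\<forall>e\<in>E. e \<subseteq> V \<and> card e = 2)"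

definition connected_graph :: "'a set \<Rightarrow> 'a set set \<Rightarrow> bool" where
  "connected_graph V E \<longleftrightarrow> (\<forall>u\<in>V. \<forall>v\<in>V. (u, v) \<in> {(x, y). {x, y} \<in> E}\<^sup>*)"

definition enumerates :: "'b list \<Rightarrow> 'b set \<Rightarrow> bool" where
  "enumerates xs X \<longleftrightarrow> distinct xs \<and> set xs = X"

(* Elements of Z_d are represented by their residues in {0..<d}. *)
definition Zmod :: "nat \<Rightarrow> int set" where
  "Zmod d = {0..<int d}"

definition valid_labeling :: "nat \<Rightarrow> 'a set set \<Rightarrow> ('a set \<Rightarrow> int) \<Rightarrow> ('a \<Rightarrow> int) \<Rightarrow> bool" where
  "valid_labeling d E fE fV \<longleftrightarrow>
     (\<forall>v v'. {v, v'} \<in> E \<longrightarrow> [fE {v, v'} = fV v + fV v'] (mod int d))"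

definition additive_labeling :: "nat \<Rightarrow> 'a set \<Rightarrow> 'a set set \<Rightarrow> ('a set \<Rightarrow> int) \<Rightarrow> bool" where
  "additive_labeling d V E fE \<longleftrightarrow> (\<exists>fV. fV \<in> V \<rightarrow> Zmod d \<and> valid_labeling d E fE fV)"

(* The list c = [v_1, ..., v_k] stands for the closed walk v_1, ..., v_k, v_1.  Its edges
   e_l = (v_l, v_(l+1)), with v_(k+1) = v_1, are indexed by l = 1, ..., k, whereas list
   positions start at 0. *)
definition cycle_edge :: "'a list \<Rightarrow> nat \<Rightarrow> 'a set" where
  "cycle_edge c l = {c ! (l - 1), c ! (l mod length c)}"

definition is_cycle :: "'a set set \<Rightarrow> 'a list \<Rightarrow> bool" where
  "is_cycle E c \<longleftrightarrow> c \<noteq> [] \<and> (\<forall>l\<in>{1..length c}. cycle_edge c l \<in> E)"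

definition even_cycle_property :: "nat \<Rightarrow> 'a set set \<Rightarrow> ('a set \<Rightarrow> int) \<Rightarrow> bool" where
  "even_cycle_property d E fE \<longleftrightarrow>
     (\<forall>c. is_cycle E c \<and> even (length c) \<longrightarrow>
        [(\<Sum>l | l \<in> {1..length c} \<and> odd l. fE (cycle_edge c l))
         = (\<Sum>l | l \<in> {1..length c} \<and> even l. fE (cycle_edge c l))] (mod int d))"

definition odd_cycle_property :: "nat \<Rightarrow> 'a set set \<Rightarrow> ('a set \<Rightarrow> int) \<Rightarrow> bool" where
  "odd_cycle_property d E fE \<longleftrightarrow>
     (\<forall>c. is_cycle E c \<and> odd (length c) \<longrightarrow>
        [int (d div 2) * (\<Sum>l\<in>{1..length c}. fE (cycle_edge c l)) = 0] (mod int d))"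

definition compatible :: "nat \<Rightarrow> 'a set set \<Rightarrow> ('a set \<Rightarrow> int) \<Rightarrow> bool" where
  "compatible d E fE \<longleftrightarrow>
     (odd d \<and> even_cycle_property d E fE) \<or>
     (even d \<and> even_cycle_property d E fE \<and> odd_cycle_property d E fE)"

definition incidence_matrix :: "'a list \<Rightarrow> 'a set list \<Rightarrow> int mat" where
  "incidence_matrix vs es =
     mat (length vs) (length es) (\<lambda>(i, j). if vs ! i \<in> es ! j then 1 else 0)"

definition mod_kernel :: "nat \<Rightarrow> int mat \<Rightarrow> int vec set" where
  "mod_kernel d A =
     {x \<in> carrier_vec (dim_col A).
        (\<forall>j<dim_col A. x $ j \<in> Zmod d) \<and>
        (\<forall>i<dim_row A. [(A *\<^sub>v x) $ i = 0] (mod int d))}"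

definition reduce_mod :: "nat \<Rightarrow> int vec \<Rightarrow> int vec" where
  "reduce_mod d x = map_vec (\<lambda>z. z mod int d) x"

(* S generates the subgroup K of the additive group Z^m. *)
definition generators_of :: "nat \<Rightarrow> int vec set \<Rightarrow> int vec set \<Rightarrow> bool" where
  "generators_of m S K \<longleftrightarrow> generate (monoid_vec TYPE(int) m) S = K"

definition label_pairing :: "'a set list \<Rightarrow> int vec \<Rightarrow> ('a set \<Rightarrow> int) \<Rightarrow> int" where
  "label_pairing es \<omega> fE = (\<Sum>j<length es. \<omega> $ j * fE (es ! j))"

(* Only meaningful if the length of c or d is even. *)
definition cycle_coeff :: "nat \<Rightarrow> 'a list \<Rightarrow> nat \<Rightarrow> int" where
  "cycle_coeff d c l = (if even (length c) then (- 1) ^ (l + 1) else int (d div 2))"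

definition cycle_vec :: "nat \<Rightarrow> 'a set list \<Rightarrow> 'a list \<Rightarrow> int vec" where
  "cycle_vec d es c =
     vec (length es) (\<lambda>j. \<Sum>l | l \<in> {1..length c} \<and> cycle_edge c l = es ! j. cycle_coeff d c l)"

end

theory Submission
  imports Defs
begin

text \<open>
  Following a walk from \<open>u\<close> to \<open>v\<close> determines the label at \<open>v\<close> as \<open>s * x + t\<close>, where \<open>x\<close> is the
  label at \<open>u\<close>, the sign \<open>s\<close> is the parity of the walk, and \<open>t\<close> is the alternating sum of its
  edge labels. A labeling can therefore be propagated from a root \<open>r\<close> as soon as every closed walk
  at \<open>r\<close> fixes the root label \<open>x\<close> modulo \<open>d\<close>. For even closed walks this is the even cycle property.
  If there is an odd cycle, take \<open>r\<close> on it and let \<open>t\<close> be its alternating sum; it only remains to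
  solve \<open>2 * x = t\<close> modulo \<open>d\<close>, and every other odd closed walk at \<open>r\<close> is then handled by
  composing it with the chosen one. For even \<open>d\<close> solvability says that \<open>t\<close> is even, which is the odd
  cycle property for this single cycle. Conversely, a valid labeling turns the pairing with \<open>\<omega>\<close>
  into a pairing with \<open>A\<^sub>G \<omega>\<close>, which vanishes on the kernel modulo \<open>d\<close>, and the latter contains all
  vectors \<open>\<omega>\<^sub>C\<close>.
\<close>

section \<open>Transport of labels along walks\<close>

text \<open>\<open>transport E f u v s t\<close>: some walk from \<open>u\<close> to \<open>v\<close> forces the label \<open>s * x + t\<close> at \<open>v\<close>
  when the label at \<open>u\<close> is \<open>x\<close>.\<close>

inductive transport :: "'a set set \<Rightarrow> ('a set \<Rightarrow> int) \<Rightarrow> 'a \<Rightarrow> 'a \<Rightarrow> int \<Rightarrow> int \<Rightarrow> bool"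
  for E f u where
  start: "transport E f u u 1 0"
| step: "transport E f u v s t \<Longrightarrow> {v, w} \<in> E \<Longrightarrow> transport E f u w (- s) (f {v, w} - t)"

lemma transport_sign:
  assumes "transport E f u v s t"
  shows "s = 1 \<or> s = -1"
  using assms by induction auto

text \<open>Composition of the affine maps \<open>x -> s * x + t\<close>. The later walk comes first
  among the premises because the induction runs over it.\<close>

lemma transport_trans:
  assumes "transport E f v w s' t'" "transport E f u v s t"
  shows "transport E f u w (s' * s) (s' * t + t')"
  using assms
proof (induction rule: transport.induct)
  case start
  then show ?case by simp
next
  case (step w s' t' w')
  then have "transport E f u w' (- (s' * s)) (f {w, w'} - (s' * t + t'))"
    by (intro transport.step) auto
  then show ?case by (simp add: algebra_simps)
qed

text \<open>As \<open>s * s = 1\<close>, the map \<open>x -> s * x + t\<close> has inverse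
  \<open>y -> s * y - s * t\<close>, realised by the reversed walk.\<close>

lemma transport_sym:
  assumes "transport E f u v s t"
  shows "transport E f v u s (- (s * t))"
  using assms
proof induction
  case start
  then show ?case using transport.start by simp
next
  case (step v s t w)
  have "transport E f w v (-1) (f {v, w})"
    using transport.step[OF transport.start, of w v E f] step.hyps
    by (simp add: insert_commute)
  from transport_trans[OF step.IH this] show ?case
    by (simp add: algebra_simps)
qed

lemma transport_exists:
  assumes "(u, v) \<in> {(x, y). {x, y} \<in> E}\<^sup>*"
  shows "\<exists>s t. transport E f u v s t"
  using assms by induction (auto intro: transport.intros)

text \<open>Pulling out \<open>- s\<close> gives the first edge the sign \<open>+\<close> whatever
  the length of the walk, as in \<open>alternating_sum\<close>.\<close>

lemma transport_imp_walk:
  assumes "transport E f u v s t"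
  shows "\<exists>p n. p 0 = u \<and> p n = v \<and> (\<forall>i<n. {p i, p (Suc i)} \<in> E) \<and> s = (-1) ^ n \<and>
           t = - s * (\<Sum>i<n. (-1) ^ i * f {p i, p (Suc i)})"
  using assms
proof induction
  case start
  show ?case by (intro exI[of _ "\<lambda>_. u"] exI[of _ 0]) simp
next
  case (step v s t w)
  then obtain p n where p: "p 0 = u" "p n = v" "\<And>i. i < n \<Longrightarrow> {p i, p (Suc i)} \<in> E"
    "s = (-1) ^ n" "t = - s * (\<Sum>i<n. (-1) ^ i * f {p i, p (Suc i)})" by blast
  define q where "q = p(Suc n := w)"
  have q: "q i = p i" if "i \<le> n" for i using that by (simp add: q_def)
  have qn: "q (Suc n) = w" by (simp add: q_def)
  have eq: "(\<Sum>i<n. (-1) ^ i * f {q i, q (Suc i)}) = (\<Sum>i<n. (-1) ^ i * f {p i, p (Suc i)})"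
    by (intro sum.cong) (auto simp: q)
  have sq: "s * (-1) ^ n = 1" by (simp add: p(4) flip: power_add)
  show ?case
  proof (intro exI[of _ q] exI[of _ "Suc n"] conjI allI impI)
    fix i assume "i < Suc n"
    then show "{q i, q (Suc i)} \<in> E"
      using p(2,3) step.hyps(2) by (cases "i = n") (auto simp: q qn)
  next
    show "f {v, w} - t = - (- s) * (\<Sum>i<Suc n. (-1) ^ i * f {q i, q (Suc i)})"
      using sq by (simp add: eq q qn p(2) p(5) distrib_left flip: mult.assoc)
  qed (use p in \<open>auto simp: q qn\<close>)
qed

definition alternating_sum :: "('a set \<Rightarrow> int) \<Rightarrow> 'a list \<Rightarrow> int" where
  "alternating_sum f c = (\<Sum>i<length c. (-1) ^ i * f (cycle_edge c (Suc i)))"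

text \<open>The second premise rules out the walk of length \<open>0\<close>, which has
  \<open>s = 1\<close> and \<open>t = 0\<close> but is no cycle.\<close>

lemma closed_transport_imp_cycle:
  assumes "transport E f r r s t" and "s = -1 \<or> t \<noteq> 0"
  shows "\<exists>c. is_cycle E c \<and> s = (-1) ^ length c \<and> t = - s * alternating_sum f c"
proof -
  obtain p n where p: "p 0 = r" "p n = r" "\<And>i. i < n \<Longrightarrow> {p i, p (Suc i)} \<in> E"
    "s = (-1) ^ n" "t = - s * (\<Sum>i<n. (-1) ^ i * f {p i, p (Suc i)})"
    using transport_imp_walk[OF assms(1)] by blast
  define c where "c = map p [0..<n]"
  have n: "n > 0" using assms(2) p(4,5) by (cases n) auto
  \<comment> \<open>For \<open>Suc i = n\<close> the list index wraps round to \<open>0\<close>,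
    which is harmless because \<open>p n = p 0\<close>.\<close>
  have edge: "cycle_edge c (Suc i) = {p i, p (Suc i)}" if "i < n" for i
    using that n p(1,2) by (cases "Suc i = n") (auto simp: cycle_edge_def c_def)
  have "is_cycle E c"
    unfolding is_cycle_def
  proof (intro conjI ballI)
    fix l assume "l \<in> {1..length c}"
    then show "cycle_edge c l \<in> E"
      using edge[of "l - 1"] p(3)[of "l - 1"] by (auto simp: c_def)
  qed (use n in \<open>simp add: c_def\<close>)
  moreover have "alternating_sum f c = (\<Sum>i<n. (-1) ^ i * f {p i, p (Suc i)})"
    unfolding alternating_sum_def by (intro sum.cong) (auto simp: edge, auto simp: c_def)
  ultimately show ?thesis
    using p(4,5) by (intro exI[of _ c]) (simp add: c_def)
qed

lemma cycle_imp_transport: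
  assumes "is_cycle E c"
  shows "transport E f (c ! 0) (c ! 0) ((-1) ^ length c)
           (- ((-1) ^ length c) * alternating_sum f c)"
proof -
  \<comment> \<open>Induction over initial segments; the index modulo \<open>length c\<close> makes
    the full segment end at \<open>c ! 0\<close> again.\<close>
  have "transport E f (c ! 0) (c ! (n mod length c)) ((-1) ^ n)
      (- ((-1) ^ n) * (\<Sum>i<n. (-1) ^ i * f (cycle_edge c (Suc i))))" if "n \<le> length c" for n
    using that
  proof (induction n)
    case 0
    show ?case using transport.start by simp
  next
    case (Suc n)
    have edge: "cycle_edge c (Suc n) = {c ! (n mod length c), c ! (Suc n mod length c)}"
      using Suc.prems by (simp add: cycle_edge_def)
    have "cycle_edge c (Suc n) \<in> E"
      using assms Suc.prems by (auto simp: is_cycle_def)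
    from transport.step[OF Suc.IH this[unfolded edge]] show ?case
      using Suc.prems by (simp add: edge distrib_left add.commute flip: mult.assoc power_add)
  qed
  from this[of "length c"] show ?thesis by (simp add: alternating_sum_def)
qed

section \<open>Existence of a valid labeling\<close>

text \<open>Edge number \<open>l = Suc i\<close> carries the sign \<open>(-1) ^ i\<close>, so
  exactly the odd-numbered edges count positively.\<close>

lemma even_cycle_property_iff:
  "even_cycle_property d E f \<longleftrightarrow>
     (\<forall>c. is_cycle E c \<and> even (length c) \<longrightarrow> [alternating_sum f c = 0] (mod int d))"
proof -
  have "(\<Sum>l | l \<in> {1..n} \<and> odd l. g l) - (\<Sum>l | l \<in> {1..n} \<and> even l. g l)
      = (\<Sum>i<n. (-1) ^ i * g (Suc i))" for n and g :: "nat \<Rightarrow> int"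
  proof (induction n)
    case (Suc n)
    have *: "{l. l \<in> {1..Suc n} \<and> P l} =
        (if P (Suc n) then insert (Suc n) {l. l \<in> {1..n} \<and> P l} else {l. l \<in> {1..n} \<and> P l})" for P
      by (auto simp: le_Suc_eq)
    show ?case
      unfolding * using Suc.IH by (auto simp: minus_one_power_iff)
  qed simp
  then show ?thesis
    unfolding even_cycle_property_def alternating_sum_def
    by (simp add: cong_iff_dvd_diff)
qed

text \<open>Each vertex gets the label transported from \<open>x\<close> along some walk. Going out
  along one walk and back along another is a closed walk at \<open>r\<close>, so by
  \<open>closed\<close> the choice of walk does not matter modulo \<open>d\<close>.\<close>

lemma additive_labeling_if_transport:
  assumes "d > 0" and "connected_graph V E" and "finite_graph V E" and "r \<in> V"
    and closed: "\<And>s t. transport E f r r s t \<Longrightarrow> [s * x + t = x] (mod int d)"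
  shows "additive_labeling d V E f"
proof -
  have unique: "[s * x + t = s' * x + t'] (mod int d)"
    if *: "transport E f r v s t" "transport E f r v s' t'" for v s t s' t'
  proof -
    have "[s' * s * x + (s' * t + - (s' * t')) = x] (mod int d)"
      by (rule closed[OF transport_trans[OF transport_sym[OF *(2)] *(1)]])
    from cong_scalar_left[OF this, of s'] have "[s' * s' * (s * x + t - t') = s' * x] (mod int d)"
      by (simp add: algebra_simps)
    moreover have "s' * s' = 1" using transport_sign[OF *(2)] by auto
    ultimately have "[s * x + t - t' + t' = s' * x + t'] (mod int d)"
      by (intro cong_add) auto
    then show ?thesis by simp
  qed
  define g where "g v = (SOME y. \<exists>s t. transport E f r v s t \<and> y = s * x + t)" for v
  have g: "[g v = s * x + t] (mod int d)" if *: "transport E f r v s t" for v s t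
  proof -
    have "\<exists>s t. transport E f r v s t \<and> g v = s * x + t"
      unfolding g_def by (rule someI_ex) (use * in blast)
    then show ?thesis using unique * by metis
  qed
  have "valid_labeling d E f (\<lambda>v. g v mod int d)"
    unfolding valid_labeling_def
  proof (intro allI impI)
    fix v w assume e: "{v, w} \<in> E"
    then have "v \<in> V" using assms(3) by (auto simp: finite_graph_def)
    then obtain s t where st: "transport E f r v s t"
      using transport_exists assms(2,4) unfolding connected_graph_def by metis
    \<comment> \<open>The label at \<open>w\<close> may be computed along the walk to
      \<open>v\<close> extended by this edge; all but the edge label cancels.\<close>
    have "[g v + g w = (s * x + t) + (- s * x + (f {v, w} - t))] (mod int d)"
      by (intro cong_add g st transport.step e)
    then show "[f {v, w} = g v mod int d + g w mod int d] (mod int d)"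
      by (simp add: cong_def mod_simps)
  qed
  moreover have "(\<lambda>v. g v mod int d) \<in> V \<rightarrow> Zmod d"
    using assms(1) by (auto simp: Zmod_def)
  ultimately show ?thesis unfolding additive_labeling_def by blast
qed

text \<open>With \<open>d = 2 * k\<close> and \<open>k > 0\<close>, the factor \<open>k\<close>
  cancels. This turns the odd cycle condition into a parity condition.\<close>

lemma dvd_half_mult_iff:
  assumes "d > 0" and "even d"
  shows "[int (d div 2) * a = 0] (mod int d) \<longleftrightarrow> even a"
proof -
  obtain k where k: "d = 2 * k" using assms(2) by (elim evenE)
  then show ?thesis using assms(1) by (simp add: cong_0_iff mult.commute)
qed

text \<open>Signs do not matter modulo 2.\<close>

lemma even_alternating_sum_iff:
  "even (alternating_sum f c) \<longleftrightarrow> even (\<Sum>l\<in>{1..length c}. f (cycle_edge c l))"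
proof -
  have "even (\<Sum>i<n. (-1) ^ i * g (Suc i)) \<longleftrightarrow> even (\<Sum>l\<in>{1..n}. g l)"
    for n and g :: "nat \<Rightarrow> int"
    by (induction n) auto
  then show ?thesis unfolding alternating_sum_def .
qed

lemma exists_half_mod:
  assumes "odd d \<or> even a"
  shows "\<exists>x. [2 * x = a] (mod int d)"
proof (cases "even a")
  case True
  then obtain b where "a = 2 * b" by (elim evenE)
  then show ?thesis by (intro exI[of _ b]) simp
next
  case False
  with assms obtain k where "d = 2 * k + 1" by (auto elim: oddE)
  \<comment> \<open>\<open>k + 1\<close> is the inverse of 2 modulo
    \<open>2 * k + 1\<close>.\<close>
  then have "2 * ((int k + 1) * a) - a = int d * a" by (simp add: algebra_simps)
  then show ?thesis by (intro exI[of _ "(int k + 1) * a"]) (simp add: cong_iff_dvd_diff)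
qed

text \<open>Since \<open>od\<close> asks for just one odd cycle with even label sum, the lemma
  serves both compatibility and the generator condition, which supplies only one such cycle.\<close>

lemma even_cycle_property_imp_additive:
  assumes "d > 0" and graph: "finite_graph V E" "connected_graph V E"
    and ev: "even_cycle_property d E f"
    and od: "even d \<Longrightarrow> \<exists>c. is_cycle E c \<and> odd (length c) \<Longrightarrow>
      \<exists>c. is_cycle E c \<and> odd (length c) \<and> even (\<Sum>l\<in>{1..length c}. f (cycle_edge c l))"
  shows "additive_labeling d V E f"
proof -
  have even_closed: "[t = 0] (mod int d)" if "transport E f r r 1 t" for r t
  proof (cases "t = 0")
    case False
    with closed_transport_imp_cycle[OF that] obtain c
      where "is_cycle E c" "1 = (-1 :: int) ^ length c" "t = - alternating_sum f c" by auto
    then show ?thesis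
      using ev unfolding even_cycle_property_iff
      by (auto simp: cong_0_iff minus_one_power_iff split: if_splits)
  qed simp
  \<comment> \<open>An empty \<open>V\<close> offers no root. Without odd cycles every closed walk
    has sign \<open>1\<close>, so any root label will do; \<open>0\<close> is taken below.\<close>
  consider "V = {}" | r where "r \<in> V" "\<nexists>c. is_cycle E c \<and> odd (length c)"
    | c where "is_cycle E c" "odd (length c)" by blast
  then show ?thesis
  proof cases
    case 1
    then have "E = {}" using graph(1) by (fastforce simp: finite_graph_def)
    then show ?thesis
      using 1 by (auto simp: additive_labeling_def valid_labeling_def)
  next
    case 2
    show ?thesis
    proof (rule additive_labeling_if_transport[OF assms(1) graph(2,1) 2(1), where x = 0])
      fix s t assume st: "transport E f r r s t"
      have "s \<noteq> -1"
        using closed_transport_imp_cycle[OF st] 2(2) by (auto simp: minus_one_power_iff split: if_splits)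
      then have "s = 1" using transport_sign[OF st] by simp
      then show "[s * 0 + t = 0] (mod int d)" using even_closed st by simp
    qed
  next
    case 3
    then obtain c where c: "is_cycle E c" "odd (length c)"
      "even d \<Longrightarrow> even (\<Sum>l\<in>{1..length c}. f (cycle_edge c l))"
      using od by blast
    define r a where "r = c ! 0" and "a = alternating_sum f c"
    have ra: "transport E f r r (-1) a"
      using cycle_imp_transport[OF c(1), of f] c(2) by (simp add: r_def a_def)
    \<comment> \<open>The chosen odd cycle sends \<open>x\<close> to \<open>a - x\<close>, so this
      congruence says that it fixes the root label.\<close>
    obtain x where x: "[2 * x = a] (mod int d)"
      using exists_half_mod[of d a] c(3) unfolding a_def even_alternating_sum_iff by blast
    have "cycle_edge c 1 \<in> E" "c \<noteq> []" using c(1) by (auto simp: is_cycle_def Suc_le_eq)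
    then have "r \<in> V" using graph(1) by (auto simp: finite_graph_def cycle_edge_def r_def)
    then show ?thesis
    proof (rule additive_labeling_if_transport[OF assms(1) graph(2,1), where x = x])
      fix s t assume st: "transport E f r r s t"
      show "[s * x + t = x] (mod int d)"
      proof (cases "s = 1")
        case True
        then show ?thesis using even_closed[of r t] st cong_add[of x x "int d" t 0] by simp
      next
        case False
        then have s: "s = -1" using transport_sign[OF st] by simp
        \<comment> \<open>Two odd closed walks at \<open>r\<close> compose to an even one, so
          \<open>t\<close> agrees with \<open>a\<close> modulo \<open>d\<close>.\<close>
        have "[a - t = 0] (mod int d)"
          using even_closed[of r "a - t"] transport_trans[OF ra st] s by simp
        then have "[a - t + (2 * x - a) = 0 + 0] (mod int d)"
          using x by (intro cong_add) (auto simp: cong_iff_dvd_diff)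
        then show ?thesis
          using s by (simp add: cong_iff_dvd_diff dvd_diff_commute algebra_simps)
      qed
    qed
  qed
qed

section \<open>Pairings with kernel vectors and with cycle vectors\<close>

lemma label_pairing_reduce_mod:
  assumes "dim_vec x = length es"
  shows "[label_pairing es (reduce_mod d x) f = label_pairing es x f] (mod int d)"
  unfolding label_pairing_def
  by (intro cong_sum cong_mult cong_refl) (auto simp: reduce_mod_def assms)

text \<open>A row of the matrix is read as an edge labeling, so that facts on
  \<open>label_pairing\<close> for arbitrary labelings also decide kernel membership.\<close>

lemma incidence_matrix_mult_vec:
  assumes "x \<in> carrier_vec (length es)" and "i < length vs"
  shows "(incidence_matrix vs es *\<^sub>v x) $ i = label_pairing es x (\<lambda>e. of_bool (vs ! i \<in> e))"
proof -
  have "(incidence_matrix vs es *\<^sub>v x) $ i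
      = (\<Sum>j\<in>{..<length es}. incidence_matrix vs es $$ (i, j) * x $ j)"
    using assms by (simp add: incidence_matrix_def scalar_prod_def lessThan_atLeast0)
  also have "\<dots> = (\<Sum>j\<in>{..<length es}. x $ j * of_bool (vs ! i \<in> es ! j))"
    by (rule sum.cong) (simp_all add: incidence_matrix_def assms(2))
  finally show ?thesis by (simp only: label_pairing_def)
qed

lemma mod_kernel_incidence_iff:
  "x \<in> mod_kernel d (incidence_matrix vs es) \<longleftrightarrow>
     x \<in> carrier_vec (length es) \<and> (\<forall>j<length es. x $ j \<in> Zmod d) \<and>
     (\<forall>v\<in>set vs. [label_pairing es x (\<lambda>e. of_bool (v \<in> e)) = 0] (mod int d))"
  using incidence_matrix_mult_vec[of x es _ vs]
  by (auto simp: mod_kernel_def incidence_matrix_def all_set_conv_all_nth)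

lemma reduce_mod_in_mod_kernel:
  assumes "d > 0" and "x \<in> carrier_vec (length es)"
    and "\<And>v. v \<in> set vs \<Longrightarrow> [label_pairing es x (\<lambda>e. of_bool (v \<in> e)) = 0] (mod int d)"
  shows "reduce_mod d x \<in> mod_kernel d (incidence_matrix vs es)"
  unfolding mod_kernel_incidence_iff
proof (intro conjI ballI)
  show "[label_pairing es (reduce_mod d x) (\<lambda>e. of_bool (v \<in> e)) = 0] (mod int d)"
    if "v \<in> set vs" for v
    by (rule cong_trans[OF label_pairing_reduce_mod assms(3)]) (use assms(2) that in auto)
qed (use assms in \<open>auto simp: reduce_mod_def Zmod_def\<close>)

lemma mat_kernel_incidence_iff:
  "x \<in> mat_kernel (incidence_matrix vs es) \<longleftrightarrow>
     x \<in> carrier_vec (length es) \<and> (\<forall>v\<in>set vs. label_pairing es x (\<lambda>e. of_bool (v \<in> e)) = 0)"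
proof -
  have "incidence_matrix vs es *\<^sub>v x = 0\<^sub>v (length vs) \<longleftrightarrow>
      (\<forall>i<length vs. (incidence_matrix vs es *\<^sub>v x) $ i = 0)"
    by (auto simp: vec_eq_iff incidence_matrix_def)
  then show ?thesis
    using incidence_matrix_mult_vec[of x es _ vs]
    by (auto simp: mat_kernel_def all_set_conv_all_nth) (auto simp: incidence_matrix_def)
qed

text \<open>Positions on the cycle are grouped by the edge traversed; distinctness of
  \<open>es\<close> makes each edge count once.\<close>

lemma label_pairing_cycle_vec:
  assumes "distinct es" and "is_cycle (set es) c"
  shows "label_pairing es (cycle_vec d es c) f
    = (\<Sum>l\<in>{1..length c}. cycle_coeff d c l * f (cycle_edge c l))"
proof -
  let ?k = "{1..length c}"
  have "label_pairing es (cycle_vec d es c) f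
      = (\<Sum>j<length es. \<Sum>l | l \<in> ?k \<and> cycle_edge c l = es ! j.
           cycle_coeff d c l * f (cycle_edge c l))"
    by (auto simp: label_pairing_def cycle_vec_def sum_distrib_right intro!: sum.cong)
  also have "\<dots> = (\<Sum>e\<in>set es. \<Sum>l | l \<in> ?k \<and> cycle_edge c l = e.
           cycle_coeff d c l * f (cycle_edge c l))"
    by (rule sum.reindex_bij_betw) (simp add: assms(1) bij_betw_nth)
  also have "\<dots> = (\<Sum>l\<in>?k. cycle_coeff d c l * f (cycle_edge c l))"
    using assms(2) by (intro sum.group) (auto simp: is_cycle_def)
  finally show ?thesis .
qed

lemma label_pairing_cycle_vec_even:
  assumes "distinct es" and "is_cycle (set es) c" and "even (length c)"
  shows "label_pairing es (cycle_vec d es c) f = alternating_sum f c"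
  using assms(3) unfolding label_pairing_cycle_vec[OF assms(1,2)] alternating_sum_def
  by (intro sum.reindex_bij_witness[of _ Suc "\<lambda>l. l - 1"])
    (auto simp: cycle_coeff_def minus_one_power_iff)

lemma label_pairing_cycle_vec_odd:
  assumes "distinct es" and "is_cycle (set es) c" and "odd (length c)"
  shows "label_pairing es (cycle_vec d es c) f
    = int (d div 2) * (\<Sum>l\<in>{1..length c}. f (cycle_edge c l))"
  using assms(3) unfolding label_pairing_cycle_vec[OF assms(1,2)]
  by (simp add: cycle_coeff_def sum_distrib_left)

text \<open>The endpoints of an edge are distinct, so at most one of the two indicators is
  \<open>1\<close>.\<close>

lemma of_bool_cycle_edge:
  assumes "is_cycle E c" and "\<forall>e\<in>E. card e = 2" and "i < length c"
  shows "(of_bool (v \<in> cycle_edge c (Suc i)) :: int)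
    = of_bool (v = c ! (i mod length c)) + of_bool (v = c ! (Suc i mod length c))"
proof -
  have "cycle_edge c (Suc i) \<in> E" using assms(1,3) by (auto simp: is_cycle_def)
  then have "card {c ! i, c ! (Suc i mod length c)} = 2"
    using assms(2) by (auto simp: cycle_edge_def)
  then show ?thesis using assms(3) by (auto simp: cycle_edge_def)
qed

lemma label_pairing_cycle_vec_incident_even:
  fixes v :: 'a
  assumes "distinct es" and "\<forall>e\<in>set es. card e = 2"
    and c: "is_cycle (set es) c" "even (length c)"
  shows "label_pairing es (cycle_vec d es c) (\<lambda>e. of_bool (v \<in> e)) = 0"
proof -
  define h :: "nat \<Rightarrow> int" where "h i = of_bool (v = c ! (i mod length c))" for i
  have incident: "of_bool (v \<in> cycle_edge c (Suc i)) = h i + h (Suc i)" if "i < length c" for i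
    unfolding h_def by (rule of_bool_cycle_edge[OF c(1) assms(2) that])
  have "alternating_sum (\<lambda>e. of_bool (v \<in> e)) c
      = (\<Sum>i<length c. (-1) ^ i * h i - (-1) ^ Suc i * h (Suc i))"
    unfolding alternating_sum_def
    by (rule sum.cong) (simp_all add: incident distrib_left)
  \<comment> \<open>Telescoping leaves \<open>h 0 - h (length c)\<close> because the length is even,
    and both indices are \<open>0\<close> modulo \<open>length c\<close>.\<close>
  also have "\<dots> = 0"
    using c(2) by (subst sum_lessThan_telescope') (simp add: h_def)
  finally show ?thesis
    using label_pairing_cycle_vec_even[OF assms(1) c] by simp
qed

text \<open>Each visit to \<open>v\<close> accounts for two incident edge positions, so their number
  is even and \<open>d div 2\<close> times it vanishes modulo \<open>d\<close>.\<close>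

lemma label_pairing_cycle_vec_incident_odd:
  fixes v :: 'a
  assumes "d > 0" and "even d" and "distinct es" and "\<forall>e\<in>set es. card e = 2"
    and c: "is_cycle (set es) c" "odd (length c)"
  shows "[label_pairing es (cycle_vec d es c) (\<lambda>e. of_bool (v \<in> e)) = 0] (mod int d)"
proof -
  define h :: "nat \<Rightarrow> int" where "h i = of_bool (v = c ! (i mod length c))" for i
  have incident: "of_bool (v \<in> cycle_edge c (Suc i)) = h i + h (Suc i)" if "i < length c" for i
    unfolding h_def by (rule of_bool_cycle_edge[OF c(1) assms(4) that])
  have "(\<Sum>l\<in>{1..length c}. of_bool (v \<in> cycle_edge c l) :: int)
      = (\<Sum>i<length c. of_bool (v \<in> cycle_edge c (Suc i)))"
    by (rule sum.reindex_bij_witness[of _ Suc "\<lambda>l. l - 1"]) auto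
  also have "\<dots> = (\<Sum>i<length c. 2 * h i + (h (Suc i) - h i))"
    by (rule sum.cong) (simp_all add: incident)
  also have "\<dots> = 2 * (\<Sum>i<length c. h i) + (h (length c) - h 0)"
    by (simp only: sum.distrib sum_lessThan_telescope sum_distrib_left)
  finally have "even (\<Sum>l\<in>{1..length c}. of_bool (v \<in> cycle_edge c l) :: int)"
    by (simp add: h_def)
  then show ?thesis
    unfolding label_pairing_cycle_vec_odd[OF assms(3) c] dvd_half_mult_iff[OF assms(1,2)] .
qed

text \<open>Membership over the integers, not only modulo \<open>d\<close>, lets generators of the
  integer kernel control all even cycles.\<close>

lemma cycle_vec_in_mat_kernel:
  assumes "distinct es" and "\<forall>e\<in>set es. card e = 2"
    and "is_cycle (set es) c" and "even (length c)"
  shows "cycle_vec d es c \<in> mat_kernel (incidence_matrix vs es)"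
  unfolding mat_kernel_incidence_iff
  using label_pairing_cycle_vec_incident_even[OF assms] by (simp add: cycle_vec_def)

lemma cycle_vec_in_mod_kernel:
  assumes "d > 0" and "distinct es" and "\<forall>e\<in>set es. card e = 2"
    and "is_cycle (set es) c" and "even (length c) \<or> even d"
  shows "reduce_mod d (cycle_vec d es c) \<in> mod_kernel d (incidence_matrix vs es)"
proof (rule reduce_mod_in_mod_kernel[OF assms(1)])
  show "[label_pairing es (cycle_vec d es c) (\<lambda>e. of_bool (v \<in> e)) = 0] (mod int d)" for v
    using label_pairing_cycle_vec_incident_even[OF assms(2-4)]
      label_pairing_cycle_vec_incident_odd[OF assms(1) _ assms(2-4)] assms(5)
    by (cases "even (length c)") auto
qed (simp add: cycle_vec_def)

section \<open>Equivalence of the conditions on cycles, kernel vectors, generators and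
  labelings\<close>

lemma compatible_iff_label_pairing_cycle_vec:
  assumes "distinct es"
  shows "compatible d (set es) f \<longleftrightarrow>
    (\<forall>c. is_cycle (set es) c \<and> (even (length c) \<or> even d) \<longrightarrow>
      [label_pairing es (reduce_mod d (cycle_vec d es c)) f = 0] (mod int d))"
proof -
  have pairing: "[label_pairing es (reduce_mod d (cycle_vec d es c)) f = 0] (mod int d) \<longleftrightarrow>
    [label_pairing es (cycle_vec d es c) f = 0] (mod int d)" for c
    using label_pairing_reduce_mod[of "cycle_vec d es c" es d f]
    by (simp add: cycle_vec_def cong_def)
  show ?thesis
    unfolding compatible_def even_cycle_property_iff odd_cycle_property_def pairing
    using label_pairing_cycle_vec_even[OF assms] label_pairing_cycle_vec_odd[OF assms]
    by (cases "even d") (auto, metis)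
qed

text \<open>Modulo \<open>d\<close>, the labeling \<open>f\<close> is the transposed incidence
  matrix applied to \<open>g\<close>. Moving the matrix to the other side pairs \<open>g\<close>
  with its product with \<open>x\<close>, which vanishes.\<close>

lemma additive_imp_label_pairing_zero:
  assumes graph: "finite_graph V (set es)" and vs: "distinct vs" "set vs = V"
    and add: "additive_labeling d V (set es) f"
    and x: "x \<in> mod_kernel d (incidence_matrix vs es)"
  shows "[label_pairing es x f = 0] (mod int d)"
proof -
  obtain g where g: "valid_labeling d (set es) f g"
    using add by (auto simp: additive_labeling_def)
  have fin: "finite V" using graph by (simp add: finite_graph_def)
  \<comment> \<open>Summing over all of \<open>V\<close> makes the index set independent of
    \<open>e\<close>, so that the two sums can be swapped.\<close>
  have edge: "[f e = (\<Sum>v\<in>V. of_bool (v \<in> e) * g v)] (mod int d)" if "e \<in> set es" for e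
  proof -
    have "card e = 2" "e \<subseteq> V" using graph that by (auto simp: finite_graph_def)
    then obtain a b where ab: "e = {a, b}" "a \<noteq> b" by (meson card_2_iff)
    have "(\<Sum>v\<in>V. of_bool (v \<in> e) * g v) = (\<Sum>v\<in>e. g v)"
      using \<open>e \<subseteq> V\<close> fin by (intro sum.mono_neutral_cong_right) auto
    then show ?thesis using g ab that by (simp add: valid_labeling_def)
  qed
  have "[label_pairing es x f = (\<Sum>j<length es. x $ j * (\<Sum>v\<in>V. of_bool (v \<in> es ! j) * g v))] (mod int d)"
    unfolding label_pairing_def by (intro cong_sum cong_mult cong_refl edge) auto
  also have "(\<Sum>j<length es. x $ j * (\<Sum>v\<in>V. of_bool (v \<in> es ! j) * g v))
      = (\<Sum>v\<in>V. label_pairing es x (\<lambda>e. of_bool (v \<in> e)) * g v)"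
    unfolding label_pairing_def sum_distrib_left sum_distrib_right
    by (subst sum.swap) (simp add: mult.assoc)
  also have "[\<dots> = (\<Sum>v\<in>V. 0 * g v)] (mod int d)"
    using x vs(2) unfolding mod_kernel_incidence_iff by (intro cong_sum cong_mult cong_refl) auto
  finally show ?thesis by simp
qed

text \<open>The pairing with \<open>f\<close> is additive, so the vectors pairing to
  \<open>0\<close> modulo \<open>n\<close> form a subgroup, which contains \<open>S\<close>.\<close>

lemma label_pairing_generate:
  assumes S: "S \<subseteq> carrier_vec (length es)"
    and zero: "\<And>x. x \<in> S \<Longrightarrow> [label_pairing es x f = 0] (mod n)"
    and x: "x \<in> generate (monoid_vec TYPE(int) (length es)) S"
  shows "[label_pairing es x f = 0] (mod n)"
proof -
  let ?M = "monoid_vec TYPE(int) (length es)"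
  interpret M: comm_group ?M by (rule comm_group_vec)
  have add: "label_pairing es (a \<otimes>\<^bsub>?M\<^esub> b) f = label_pairing es a f + label_pairing es b f"
    if "a \<in> carrier ?M" "b \<in> carrier ?M" for a b
    using that by (simp add: label_pairing_def monoid_vec_simps distrib_right sum.distrib)
  have one: "label_pairing es \<one>\<^bsub>?M\<^esub> f = 0"
    by (simp add: label_pairing_def monoid_vec_simps)
  have carrier: "S \<subseteq> carrier ?M" using S by (simp add: monoid_vec_simps)
  show ?thesis using x
  proof induction
    case one
    then show ?case using \<open>label_pairing es \<one>\<^bsub>?M\<^esub> f = 0\<close> by simp
  next
    case (incl h)
    then show ?case by (rule zero)
  next
    case (inv h)
    then have "label_pairing es h f + label_pairing es (inv\<^bsub>?M\<^esub> h) f = 0"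
      using add[of h "inv\<^bsub>?M\<^esub> h"] one carrier by auto
    then have "label_pairing es (inv\<^bsub>?M\<^esub> h) f = - label_pairing es h f" by simp
    then show ?case using zero[OF inv] by (simp add: cong_0_iff)
  next
    case (eng a b)
    have "a \<in> carrier ?M" "b \<in> carrier ?M"
      using eng.hyps M.generate_in_carrier[OF carrier] by auto
    then show ?case using add cong_add[OF eng.IH] by simp
  qed
qed

theorem theorem3:
  fixes d :: nat
    and V :: "'a set" and E :: "'a set set"
    and vs :: "'a list" and es :: "'a set list"
    and fE :: "'a set \<Rightarrow> int"
  assumes "d > 0"
    and "finite_graph V E" and "connected_graph V E"
    and "enumerates vs V" and "enumerates es E"
    and "fE \<in> E \<rightarrow> Zmod d"
  shows
    "(compatible d E fE \<longleftrightarrow>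
        (\<forall>c. is_cycle E c \<and> (even (length c) \<or> even d) \<longrightarrow>
           [label_pairing es (reduce_mod d (cycle_vec d es c)) fE = 0] (mod int d)))
     \<and>
     (compatible d E fE \<longleftrightarrow>
        (\<forall>\<omega>\<in>mod_kernel d (incidence_matrix vs es).
           [label_pairing es \<omega> fE = 0] (mod int d)))
     \<and>
     (\<forall>S. finite S \<and> generators_of (length es) S (mat_kernel (incidence_matrix vs es)) \<longrightarrow>
        (compatible d E fE \<longleftrightarrow>
          (if odd d \<or> \<not> (\<exists>c. is_cycle E c \<and> odd (length c))
           then (\<forall>\<omega>\<in>reduce_mod d ` S. [label_pairing es \<omega> fE = 0] (mod int d))
           else (\<forall>\<omega>\<in>reduce_mod d ` S. [label_pairing es \<omega> fE = 0] (mod int d)) \<and>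
                (\<exists>c. is_cycle E c \<and> odd (length c) \<and>
                   [label_pairing es (reduce_mod d (cycle_vec d es c)) fE = 0] (mod int d)))))
     \<and>
     (compatible d E fE \<longleftrightarrow> additive_labeling d V E fE)"
proof -
  let ?A = "incidence_matrix vs es"
  let ?zero = "\<lambda>\<omega>. [label_pairing es \<omega> fE = 0] (mod int d)"
  let ?C = "\<lambda>c. reduce_mod d (cycle_vec d es c)"
  have es: "distinct es" "E = set es" and vs: "distinct vs" "set vs = V"
    using assms(4,5) by (auto simp: enumerates_def)
  have card: "\<forall>e\<in>set es. card e = 2"
    using assms(2) by (simp add: finite_graph_def es(2))
  have compatible_iff: "compatible d E fE \<longleftrightarrow>
      (\<forall>c. is_cycle E c \<and> (even (length c) \<or> even d) \<longrightarrow> ?zero (?C c))"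
    unfolding es(2) by (rule compatible_iff_label_pairing_cycle_vec[OF es(1)])
  have odd_cycle: "even (\<Sum>l\<in>{1..length c}. fE (cycle_edge c l))"
    if "is_cycle E c" "odd (length c)" "even d" "?zero (?C c)" for c
  proof -
    have "[label_pairing es (cycle_vec d es c) fE = 0] (mod int d)"
      using label_pairing_reduce_mod[of "cycle_vec d es c" es d fE] that(4)
      by (auto simp: cycle_vec_def cong_def)
    then show ?thesis
      using that(1,2) dvd_half_mult_iff[OF assms(1) that(3)]
        label_pairing_cycle_vec_odd[OF es(1)] unfolding es(2) by metis
  qed
  note additiveI = even_cycle_property_imp_additive[OF assms(1-3)]
  have i_ii: "?zero (?C c)" if "compatible d E fE" "is_cycle E c" "even (length c) \<or> even d" for c
    using that(1)[unfolded compatible_iff] that(2,3) by simp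
  have i_v: "additive_labeling d V E fE" if comp: "compatible d E fE"
  proof (rule additiveI)
    show "even_cycle_property d E fE" using that by (auto simp: compatible_def)
    assume "even d" and "\<exists>c. is_cycle E c \<and> odd (length c)"
    then show "\<exists>c. is_cycle E c \<and> odd (length c) \<and> even (\<Sum>l\<in>{1..length c}. fE (cycle_edge c l))"
      using odd_cycle i_ii[OF comp] by metis
  qed
  have v_iii: "?zero \<omega>" if "additive_labeling d V E fE" "\<omega> \<in> mod_kernel d ?A" for \<omega>
    using additive_imp_label_pairing_zero[OF _ vs] assms(2) that unfolding es(2) by blast
  have iii_i: "compatible d E fE" if "\<And>\<omega>. \<omega> \<in> mod_kernel d ?A \<Longrightarrow> ?zero \<omega>"
    unfolding compatible_iff
    using that cycle_vec_in_mod_kernel[OF assms(1) es(1) card] unfolding es(2) by blast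
  \<comment> \<open>The case distinction of the statement is recast as one conjunction, whose second
    part has content only for even \<open>d\<close> with an odd cycle present.\<close>
  have iv: "compatible d E fE \<longleftrightarrow>
      (\<forall>\<omega>\<in>reduce_mod d ` S. ?zero \<omega>) \<and>
      (even d \<and> (\<exists>c. is_cycle E c \<and> odd (length c)) \<longrightarrow>
        (\<exists>c. is_cycle E c \<and> odd (length c) \<and> ?zero (?C c)))"
    (is "_ \<longleftrightarrow> ?gen \<and> ?odd")
    if S: "generators_of (length es) S (mat_kernel ?A)" for S
  proof -
    have gen: "generate (monoid_vec TYPE(int) (length es)) S = mat_kernel ?A"
      using S by (simp add: generators_of_def)
    then have SK: "x \<in> mat_kernel ?A" if "x \<in> S" for x using generate.incl that by metis
    have SC: "S \<subseteq> carrier_vec (length es)"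
      using SK mat_kernel_incidence_iff by blast
    show ?thesis
    proof (intro iffI conjI)
      assume comp: "compatible d E fE"
      have "reduce_mod d x \<in> mod_kernel d ?A" if "x \<in> S" for x
        using SK[OF that] unfolding mat_kernel_incidence_iff
        by (intro reduce_mod_in_mod_kernel[OF assms(1)]) auto
      then show ?gen using v_iii[OF i_v[OF comp]] by auto
      show ?odd using i_ii[OF comp] by metis
    next
      assume iv: "?gen \<and> ?odd"
      \<comment> \<open>Generation takes place over the integers, so the hypothesis is first lifted
        from the reduced generators to \<open>S\<close> itself.\<close>
      have "?zero x" if "x \<in> S" for x
      proof (rule cong_trans[OF cong_sym])
        show "[label_pairing es (reduce_mod d x) fE = label_pairing es x fE] (mod int d)"
          using SC that by (intro label_pairing_reduce_mod) auto
      qed (use iv that in simp)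
      from label_pairing_generate[OF SC this] have kernel: "?zero x" if "x \<in> mat_kernel ?A" for x
        using that unfolding gen by simp
      have "even_cycle_property d E fE"
        unfolding even_cycle_property_iff es(2)
      proof (intro allI impI)
        fix c assume "is_cycle (set es) c \<and> even (length c)"
        then have c: "is_cycle (set es) c" "even (length c)" by simp_all
        show "[alternating_sum fE c = 0] (mod int d)"
          using kernel[OF cycle_vec_in_mat_kernel[OF es(1) card c]]
          by (simp add: label_pairing_cycle_vec_even[OF es(1) c])
      qed
      then have "additive_labeling d V E fE"
      proof (rule additiveI)
        assume "even d" and "\<exists>c. is_cycle E c \<and> odd (length c)"
        then show "\<exists>c. is_cycle E c \<and> odd (length c) \<and>
            even (\<Sum>l\<in>{1..length c}. fE (cycle_edge c l))"
          using iv odd_cycle by metis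
      qed
      \<comment> \<open>A labeling makes every vector of the kernel modulo \<open>d\<close> pair to
        \<open>0\<close>, in particular the reduced cycle vectors.\<close>
      then show "compatible d E fE" using v_iii iii_i by simp
    qed
  qed
  show ?thesis
  proof (intro conjI allI impI)
    show "compatible d E fE \<longleftrightarrow> (\<forall>\<omega>\<in>mod_kernel d ?A. ?zero \<omega>)"
      using v_iii[OF i_v] iii_i by metis
    show "compatible d E fE \<longleftrightarrow> additive_labeling d V E fE"
      using i_v v_iii iii_i by metis
    fix S assume "finite S \<and> generators_of (length es) S (mat_kernel ?A)"
    then have S: "generators_of (length es) S (mat_kernel ?A)" by simp
    show "compatible d E fE \<longleftrightarrow>
          (if odd d \<or> \<not> (\<exists>c. is_cycle E c \<and> odd (length c))
           then (\<forall>\<omega>\<in>reduce_mod d ` S. ?zero \<omega>)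
           else (\<forall>\<omega>\<in>reduce_mod d ` S. ?zero \<omega>) \<and>
                (\<exists>c. is_cycle E c \<and> odd (length c) \<and> ?zero (?C c)))"
      by (subst iv[OF S]) argo
  qed (fact compatible_iff)
qed

end
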